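(* Let $n\ge 3$ and let $P_n(R)$ be a regular $n$-gon with circumradius $R>0$. Then $P_n(R)$ has exactly $n-1$ cyclic averages, namely $$S_n^{(2)},S_n^{(4)},\dots,S_n^{(2n-2)};$$ that is, for a positive integer $m$, the cyclic average $S_n^{(2m)}$ exists if and only if $1\le m\le n-1$.
   Context: Let $A_1,\dots,A_n$ be the vertices and $O$ the centroid of $P_n(R)$. For a point $M$ of the plane put $d_i=|MA_i|$ and $L=|MO|$. For a positive integer $m$, the sum $\sum_{i=1}^n d_i^{2m}$ is called a $\sum_{[R,L]}$ sum if, for every $L$, its value is the same for all points $M$ of the circle $C(O,L)$ with center $O$ and radius $L$ (so the value depends only on $R$ and $L$). In that case one says that the cyclic average of order $2m$ exists, and it is defined as $S_n^{(2m)}=\frac1n\sum_{i=1}^n d_i^{2m}$. *)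

theory Defs
  imports "HOL-Analysis.Analysis"
begin

text \<open>
  The Euclidean plane is \<^typ>\<open>complex\<close>. A regular polygon may have any centre, any angular
  position, and either orientation \<open>s\<close> of the labelling; its vertices are \<open>A 1, \<dots>, A n\<close>, and
  values of \<open>A\<close> at other indices are irrelevant.
\<close>

definition regular_ngon :: "nat \<Rightarrow> real \<Rightarrow> (nat \<Rightarrow> complex) \<Rightarrow> bool" where
  "regular_ngon n R A \<longleftrightarrow>
     (\<exists>c \<phi>. \<exists>s\<in>{1, -1}. \<forall>i\<in>{1..n}.
        A i = c + of_real R * cis (\<phi> + s * (2 * pi * real i / real n)))"

definition centroid :: "nat \<Rightarrow> (nat \<Rightarrow> complex) \<Rightarrow> complex" where
  "centroid n A = (\<Sum>i=1..n. A i) / of_nat n"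

definition dist_power_sum :: "nat \<Rightarrow> (nat \<Rightarrow> complex) \<Rightarrow> nat \<Rightarrow> complex \<Rightarrow> real" where
  "dist_power_sum n A m M = (\<Sum>i=1..n. dist M (A i) ^ (2 * m))"

definition is_RL_sum :: "nat \<Rightarrow> (nat \<Rightarrow> complex) \<Rightarrow> nat \<Rightarrow> bool" where
  "is_RL_sum n A m \<longleftrightarrow>
     (\<forall>L\<ge>0. \<forall>M\<in>sphere (centroid n A) L. \<forall>M'\<in>sphere (centroid n A) L.
        dist_power_sum n A m M = dist_power_sum n A m M')"

text \<open>
  The cyclic average of order \<open>2 * m\<close> of a given polygon is a function \<open>S\<close> of the distance \<open>L\<close>
  from the centroid; only its values at \<open>L \<ge> 0\<close> are meaningful.
\<close>

definition is_cyclic_average ::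
    "nat \<Rightarrow> (nat \<Rightarrow> complex) \<Rightarrow> nat \<Rightarrow> (real \<Rightarrow> real) \<Rightarrow> bool" where
  "is_cyclic_average n A m S \<longleftrightarrow>
     is_RL_sum n A m \<and>
     (\<forall>L\<ge>0. \<forall>M\<in>sphere (centroid n A) L. S L = 1 / real n * dist_power_sum n A m M)"

definition cyclic_average_exists :: "nat \<Rightarrow> (nat \<Rightarrow> complex) \<Rightarrow> nat \<Rightarrow> bool" where
  "cyclic_average_exists n A m \<longleftrightarrow> (\<exists>S. is_cyclic_average n A m S)"

end

theory Submission
  imports Defs "HOL-Number_Theory.Cong"
begin

text \<open>
  Up to scaling and rotation, the distance from a point to the \<open>i\<close>-th vertex is \<open>|z + \<zeta>\<^sub>i|\<close>
  with \<open>\<zeta>\<^sub>i\<close> running through the \<open>n\<close>-th roots of unity. Expanding \<open>|z + \<zeta>\<^sub>i|\<^sup>2\<^sup>m\<close> as the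
  product of \<open>(z + \<zeta>\<^sub>i)\<^sup>m\<close> with its conjugate and summing over \<open>i\<close> leaves \<open>n\<close> times the terms
  \<open>C(m,k) C(m,l) z\<^sup>k (cnj z)\<^sup>l\<close> with \<open>k \<equiv> l (mod n)\<close>. For \<open>m < n\<close> only \<open>k = l\<close> survives, and
  the sum depends on \<open>|z|\<close> alone. For \<open>m \<ge> n\<close>, all terms are positive at \<open>z = 1\<close>; moving to
  \<open>z = cis (\<pi>/n)\<close> keeps \<open>|z| = 1\<close> and does not increase any real part, but flips the sign of
  the term \<open>k = n, l = 0\<close>.
\<close>

section \<open>Orthogonality of the roots of unity\<close>

lemma cis_eq_1_iff: "cis x = 1 \<longleftrightarrow> (\<exists>j::int. x = 2 * pi * of_int j)"
  by (auto simp: cis_conv_exp exp_eq_1 algebra_simps)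

text \<open>The summands are the powers \<open>q ^ i\<close> of the \<open>d\<close>-th power
  \<open>q\<close> of the first root. Since \<open>q ^ n = 1\<close>, the geometric sum vanishes
  unless \<open>q = 1\<close>. Exponents are integers because differences \<open>l - k\<close> of
  either sign occur later; \<open>s\<close> covers both orientations.\<close>

lemma sum_cis_multiples:
  fixes d :: int and s :: real
  assumes n: "n > 0" and s: "s \<in> {1, -1}"
  shows "(\<Sum>i=1..n. cis (s * (2 * pi * real i / real n)) powi d) =
           (if int n dvd d then of_nat n else 0)"
proof -
  define q where "q = cis (s * (2 * pi * of_int d / real n))"
  have q_pow: "cis (s * (2 * pi * real i / real n)) powi d = q ^ i" for i
    unfolding q_def Complex.DeMoivre cis_power_int by (rule arg_cong[where f = cis]) simp
  have qn: "q ^ n = 1"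
  proof -
    have "q ^ n = cis (real n * (s * (2 * pi * of_int d / real n)))"
      unfolding q_def Complex.DeMoivre ..
    also have "real n * (s * (2 * pi * of_int d / real n)) =
        2 * pi * of_int (if s = 1 then d else -d)"
      using n s by auto
    also have "cis \<dots> = 1"
      unfolding cis_eq_1_iff by blast
    finally show ?thesis .
  qed
  have q1: "q = 1 \<longleftrightarrow> int n dvd d"
  proof
    assume "q = 1"
    then obtain j :: int where "s * (2 * pi * of_int d / real n) = 2 * pi * of_int j"
      unfolding q_def cis_eq_1_iff by blast
    then have "s * of_int d = real n * of_int j"
      using n by (simp add: field_simps)
    then have "real_of_int d = of_int (int n * j) \<or> real_of_int d = of_int (int n * (-j))"
      using s by auto
    then have "d = int n * j \<or> d = int n * (-j)"
      unfolding of_int_eq_iff .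
    then show "int n dvd d" by auto
  next
    assume "int n dvd d"
    then obtain j where "d = int n * j" by blast
    then have "s * (2 * pi * of_int d / real n) = 2 * pi * of_int (if s = 1 then j else -j)"
      using n s by auto
    then show "q = 1" unfolding q_def cis_eq_1_iff by blast
  qed
  have "(\<Sum>i=1..n. q ^ i) = (if q = 1 then of_nat n else 0)"
  proof (cases "q = 1")
    case False
    \<comment> \<open>Shifting the range from \<open>1..n\<close> to \<open>0..n-1\<close> costs a
      factor \<open>q\<close>; what remains is \<open>(q ^ n - 1) / (q - 1)\<close>, whose numerator
      is 0.\<close>
    have "(\<Sum>i=1..n. q ^ i) = q * (\<Sum>i<n. q ^ i)"
      by (simp add: sum_distrib_left sum.atLeast1_atMost_eq)
    also have "\<dots> = 0"
      using False qn by (simp add: geometric_sum)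
    finally show ?thesis using False by simp
  qed simp
  then show ?thesis unfolding q_pow q1 .
qed

section \<open>The power sum over the roots of unity and how it varies on a circle\<close>

lemma sum_norm_plus_roots_power:
  fixes z :: complex and s :: real
  assumes n: "n > 0" and s: "s \<in> {1, -1}"
  shows "of_real (\<Sum>i=1..n. norm (z + cis (s * (2 * pi * real i / real n))) ^ (2 * m)) =
           of_nat n * (\<Sum>k\<le>m. \<Sum>l\<le>m. if [k = l] (mod n)
             then of_nat (m choose k) * of_nat (m choose l) * z ^ k * cnj z ^ l else 0)"
proof -
  define \<zeta> where "\<zeta> i = cis (s * (2 * pi * real i / real n))" for i :: nat
  define a where "a k l = of_nat (m choose k) * of_nat (m choose l) * z ^ k * cnj z ^ l" for k l
  have \<zeta>: "\<zeta> i ^ (m - k) * cnj (\<zeta> i) ^ (m - l) = \<zeta> i powi (int l - int k)"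
    if "k \<le> m" "l \<le> m" for i k l
  proof -
    have nz: "\<zeta> i \<noteq> 0" by (simp add: \<zeta>_def)
    \<comment> \<open>On the unit circle conjugation is inversion, so both powers merge into one
      integer power.\<close>
    have "cnj (\<zeta> i) = inverse (\<zeta> i)" by (simp add: \<zeta>_def cis_cnj)
    then have "\<zeta> i ^ (m - k) * cnj (\<zeta> i) ^ (m - l) =
        \<zeta> i powi (int (m - k)) * \<zeta> i powi (- int (m - l))"
      by (simp add: power_int_minus power_inverse)
    also have "\<dots> = \<zeta> i powi (int (m - k) - int (m - l))"
      by (simp only: diff_conv_add_uminus power_int_add[OF disjI1[OF nz]])
    also have "int (m - k) - int (m - l) = int l - int k" using that by simp
    finally show ?thesis .
  qed
  have norm_power: "of_real (norm (z + \<zeta> i) ^ (2 * m)) =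
      (\<Sum>k\<le>m. \<Sum>l\<le>m. a k l * \<zeta> i powi (int l - int k))" for i
  proof -
    have "of_real (norm (z + \<zeta> i) ^ (2 * m)) = of_real ((norm (z + \<zeta> i))\<^sup>2) ^ m"
      by (simp add: power_mult)
    also have "\<dots> = (z + \<zeta> i) ^ m * (cnj z + cnj (\<zeta> i)) ^ m"
      unfolding complex_norm_square by (simp add: power_mult_distrib)
    also have "\<dots> = (\<Sum>k\<le>m. \<Sum>l\<le>m. (of_nat (m choose k) * z ^ k * \<zeta> i ^ (m - k)) *
        (of_nat (m choose l) * cnj z ^ l * cnj (\<zeta> i) ^ (m - l)))"
      by (simp add: binomial_ring sum_product)
    also have "\<dots> = (\<Sum>k\<le>m. \<Sum>l\<le>m. a k l * (\<zeta> i ^ (m - k) * cnj (\<zeta> i) ^ (m - l)))"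
      by (simp add: a_def mult_ac)
    also have "\<dots> = (\<Sum>k\<le>m. \<Sum>l\<le>m. a k l * \<zeta> i powi (int l - int k))"
      by (intro sum.cong refl) (simp add: \<zeta>)
    finally show ?thesis .
  qed
  have "of_real (\<Sum>i=1..n. norm (z + \<zeta> i) ^ (2 * m)) =
      (\<Sum>i=1..n. \<Sum>k\<le>m. \<Sum>l\<le>m. a k l * \<zeta> i powi (int l - int k))"
    unfolding of_real_sum norm_power ..
  also have "\<dots> = (\<Sum>k\<le>m. \<Sum>l\<le>m. a k l * (\<Sum>i=1..n. \<zeta> i powi (int l - int k)))"
    unfolding sum_distrib_left
    by (rule trans[OF sum.swap], rule sum.cong[OF refl], rule sum.swap)
  also have "\<dots> = (\<Sum>k\<le>m. \<Sum>l\<le>m. of_nat n * (if [k = l] (mod n) then a k l else 0))"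
    unfolding \<zeta>_def sum_cis_multiples[OF n s]
    by (intro sum.cong refl)
       (auto simp flip: cong_int_iff simp: cong_iff_dvd_diff dvd_diff_commute)
  finally show ?thesis
    unfolding \<zeta>_def a_def sum_distrib_left .
qed

lemma sum_norm_plus_roots_power_invariant:
  fixes z z' :: complex and s :: real
  assumes "m < n" and "s \<in> {1, -1}" and "norm z = norm z'"
  shows "(\<Sum>i=1..n. norm (z + cis (s * (2 * pi * real i / real n))) ^ (2 * m)) =
         (\<Sum>i=1..n. norm (z' + cis (s * (2 * pi * real i / real n))) ^ (2 * m))"
proof -
  have n: "n > 0" using assms(1) by simp
  have *: "(if [k = l] (mod n)
        then of_nat (m choose k) * of_nat (m choose l) * z ^ k * cnj z ^ l else 0) =
      (if [k = l] (mod n)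
        then of_nat (m choose k) * of_nat (m choose l) * z' ^ k * cnj z' ^ l else 0)"
    if "k \<le> m" "l \<le> m" for k l
  proof (cases "k = l")
    case True
    have "z * cnj z = z' * cnj z'"
      using assms(3) by (simp flip: complex_norm_square)
    then have "z ^ k * cnj z ^ k = z' ^ k * cnj z' ^ k"
      by (simp flip: power_mult_distrib)
    with True show ?thesis by (simp add: mult.assoc)
  next
    case False
    \<comment> \<open>Both \<open>k\<close> and \<open>l\<close> are at most \<open>m < n\<close>,
      hence equal to their own residues.\<close>
    then have "\<not> [k = l] (mod n)"
      using that assms(1) by (simp add: cong_def)
    then show ?thesis by simp
  qed
  have "complex_of_real (\<Sum>i=1..n. norm (z + cis (s * (2 * pi * real i / real n))) ^ (2 * m)) =
        of_real (\<Sum>i=1..n. norm (z' + cis (s * (2 * pi * real i / real n))) ^ (2 * m))"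
    unfolding sum_norm_plus_roots_power[OF n assms(2)]
    by (intro arg_cong2[where f = "(*)"] sum.cong refl *) simp_all
  then show ?thesis unfolding of_real_eq_iff .
qed

lemma sum_norm_plus_roots_power_less:
  fixes s :: real
  assumes "0 < n" and "n \<le> m" and "s \<in> {1, -1}"
  shows "(\<Sum>i=1..n. norm (cis (pi / real n) + cis (s * (2 * pi * real i / real n))) ^ (2 * m)) <
         (\<Sum>i=1..n. norm (1 + cis (s * (2 * pi * real i / real n))) ^ (2 * m))"
proof -
  \<comment> \<open>Single terms of the expansion need not be real, but their sum is. Passing to
    real parts allows a termwise comparison.\<close>
  define F where "F z = (\<Sum>k\<le>m. \<Sum>l\<le>m. if [k = l] (mod n)
             then real (m choose k) * real (m choose l) * Re (z ^ k * cnj z ^ l) else 0)" for z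
  have F: "(\<Sum>i=1..n. norm (z + cis (s * (2 * pi * real i / real n))) ^ (2 * m)) = real n * F z" for z
  proof -
    have "(\<Sum>i=1..n. norm (z + cis (s * (2 * pi * real i / real n))) ^ (2 * m)) =
      Re (of_nat n * (\<Sum>k\<le>m. \<Sum>l\<le>m. if [k = l] (mod n)
             then of_nat (m choose k) * of_nat (m choose l) * z ^ k * cnj z ^ l else 0))"
      unfolding sum_norm_plus_roots_power[OF assms(1,3), symmetric] by simp
    also have "\<dots> = real n * F z"
      unfolding F_def Re_sum Re_complex_of_real
      by (simp add: mult.assoc if_distrib[of Re] cong: if_cong)
    finally show ?thesis .
  qed
  define w where "w = cis (pi / real n)"
  have le1: "Re (w ^ k * cnj w ^ l) \<le> 1" for k l
    using complex_Re_le_cmod[of "w ^ k * cnj w ^ l"]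
    by (simp add: w_def norm_mult norm_power)
  have wn: "w ^ n = -1" using assms(1) by (simp add: w_def Complex.DeMoivre)
  \<comment> \<open>The coefficients are nonnegative and every monomial equals 1 at
    \<open>z = 1\<close>, the largest real part possible on the unit circle.\<close>
  have le: "(if [k = l] (mod n)
        then real (m choose k) * real (m choose l) * Re (w ^ k * cnj w ^ l) else 0) \<le>
      (if [k = l] (mod n)
        then real (m choose k) * real (m choose l) * Re (1 ^ k * cnj 1 ^ l) else 0)" for k l
    using mult_left_mono[OF le1[of k l], of "real (m choose k) * real (m choose l)"] by simp
  have "F w < F 1"
    unfolding F_def
  proof (rule sum_strict_mono_ex1)
    show "\<exists>k\<in>{..m}. (\<Sum>l\<le>m. if [k = l] (mod n)
        then real (m choose k) * real (m choose l) * Re (w ^ k * cnj w ^ l) else 0) <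
      (\<Sum>l\<le>m. if [k = l] (mod n)
        then real (m choose k) * real (m choose l) * Re (1 ^ k * cnj 1 ^ l) else 0)"
    \<comment> \<open>The strict term is \<open>k = n\<close>, \<open>l = 0\<close>, which lies in
      range because \<open>n \<le> m\<close>: its monomial is \<open>w ^ n = -1\<close> against 1,
      with positive coefficient.\<close>
    proof (rule bexI[of _ n], rule sum_strict_mono_ex1)
      show "\<exists>l\<in>{..m}. (if [n = l] (mod n)
          then real (m choose n) * real (m choose l) * Re (w ^ n * cnj w ^ l) else 0) <
        (if [n = l] (mod n)
          then real (m choose n) * real (m choose l) * Re (1 ^ n * cnj 1 ^ l) else 0)"
        using assms(2) by (intro bexI[of _ 0]) (auto simp: wn cong_def)
    qed (use assms(2) le in blast)+
  qed (use le in \<open>auto intro: sum_mono\<close>)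
  then show ?thesis
    unfolding F w_def[symmetric] using assms(1) by simp
qed

section \<open>Transfer to an arbitrary regular polygon\<close>

lemma centroid_regular_ngon:
  assumes "n \<ge> 2" and "s \<in> {1, -1}"
    and A: "\<And>i. i \<in> {1..n} \<Longrightarrow> A i = c + of_real R * cis (\<phi> + s * (2 * pi * real i / real n))"
  shows "centroid n A = c"
proof -
  \<comment> \<open>Orthogonality with \<open>d = 1\<close>: for \<open>n \<ge> 2\<close>,
    \<open>n\<close> does not divide 1.\<close>
  have "(\<Sum>i=1..n. cis (s * (2 * pi * real i / real n))) = 0"
    using sum_cis_multiples[of n s 1] assms(1,2) by (simp add: zdvd1_eq)
  then have "(\<Sum>i=1..n. of_real R * cis \<phi> * cis (s * (2 * pi * real i / real n))) = 0"
    by (simp flip: sum_distrib_left)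
  then have "(\<Sum>i=1..n. A i) = of_nat n * c"
    by (simp add: A sum.distrib mult.assoc flip: cis_mult)
  then show ?thesis using assms(1) by (simp add: centroid_def)
qed

text \<open>Here \<open>z\<close> is the coordinate of the point with origin \<open>c\<close> and
  unit \<open>- R * cis \<phi>\<close>. The minus sign turns differences from vertices into sums
  \<open>z + \<zeta>\<close>, so the binomial expansion has no alternating signs.\<close>

lemma dist_power_sum_regular_ngon:
  assumes "R > 0"
    and A: "\<And>i. i \<in> {1..n} \<Longrightarrow> A i = c + of_real R * cis (\<phi> + s * (2 * pi * real i / real n))"
  shows "dist_power_sum n A m (c - of_real R * cis \<phi> * z) =
    R ^ (2 * m) * (\<Sum>i=1..n. norm (z + cis (s * (2 * pi * real i / real n))) ^ (2 * m))"
proof -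
  have "dist (c - of_real R * cis \<phi> * z) (A i) =
      R * norm (z + cis (s * (2 * pi * real i / real n)))" if "i \<in> {1..n}" for i
  proof -
    have "c - of_real R * cis \<phi> * z - A i =
        - (of_real R * cis \<phi> * (z + cis (s * (2 * pi * real i / real n))))"
      using A[OF that] by (simp add: cis_mult[symmetric] algebra_simps)
    then show ?thesis
      using assms(1) by (simp add: dist_norm norm_mult)
  qed
  then show ?thesis
    by (simp add: dist_power_sum_def power_mult_distrib sum_distrib_left)
qed

lemma cyclic_average_exists_iff_RL_sum: "cyclic_average_exists n A m \<longleftrightarrow> is_RL_sum n A m"
proof
  assume *: "is_RL_sum n A m"
  \<comment> \<open>Any point of the circle serves as sample, by invariance; the one in the positive
    real direction is taken.\<close>
  define S where "S L = 1 / real n * dist_power_sum n A m (centroid n A + of_real L)" for L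
  have "is_cyclic_average n A m S"
    unfolding is_cyclic_average_def
  proof (intro conjI allI impI ballI *)
    fix L :: real and M
    assume L: "0 \<le> L" and M: "M \<in> sphere (centroid n A) L"
    have "centroid n A + of_real L \<in> sphere (centroid n A) L"
      using L by (simp add: dist_norm)
    then have "dist_power_sum n A m (centroid n A + of_real L) = dist_power_sum n A m M"
      using * L M unfolding is_RL_sum_def by blast
    then show "S L = 1 / real n * dist_power_sum n A m M"
      by (simp add: S_def)
  qed
  then show "cyclic_average_exists n A m"
    unfolding cyclic_average_exists_def by blast
qed (auto simp: cyclic_average_exists_def is_cyclic_average_def)

lemma is_RL_sum_regular_ngon_iff:
  assumes n: "n \<ge> 2" and R: "R > 0" and "regular_ngon n R A"
  shows "is_RL_sum n A m \<longleftrightarrow> m < n"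
proof -
  obtain c \<phi> s where s: "s \<in> {1, -1}"
    and A: "\<And>i. i \<in> {1..n} \<Longrightarrow> A i = c + of_real R * cis (\<phi> + s * (2 * pi * real i / real n))"
    using assms(3) unfolding regular_ngon_def by blast
  have c: "centroid n A = c" by (rule centroid_regular_ngon[OF n s A])
  have sum_eq: "dist_power_sum n A m (c - of_real R * cis \<phi> * z) =
      R ^ (2 * m) * (\<Sum>i=1..n. norm (z + cis (s * (2 * pi * real i / real n))) ^ (2 * m))" for z
    by (rule dist_power_sum_regular_ngon[OF R A])
  show ?thesis
  proof
    assume RL: "is_RL_sum n A m"
    show "m < n"
    proof (rule ccontr)
      assume "\<not> m < n"
      \<comment> \<open>The circumscribed circle \<open>L = R\<close> corresponds to
        \<open>norm z = 1\<close> and already refutes invariance.\<close>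
      have "c - of_real R * cis \<phi> * z \<in> sphere (centroid n A) R" if "norm z = 1" for z
        using R that by (simp add: c dist_norm norm_mult)
      from this[of 1] this[of "cis (pi / real n)"]
      have "dist_power_sum n A m (c - of_real R * cis \<phi> * 1) =
            dist_power_sum n A m (c - of_real R * cis \<phi> * cis (pi / real n))"
        using RL R unfolding is_RL_sum_def by (metis less_imp_le norm_cis norm_one)
      then show False
        unfolding sum_eq using sum_norm_plus_roots_power_less[OF _ _ s, of n m] n R \<open>\<not> m < n\<close>
        by (simp only: mult_cancel_left) simp
    qed
  next
    assume m: "m < n"
    show "is_RL_sum n A m"
      unfolding is_RL_sum_def
    proof (intro allI impI ballI)
      fix L :: real and M M'
      assume "M \<in> sphere (centroid n A) L" and "M' \<in> sphere (centroid n A) L"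
      then have L: "norm (c - M) = L" "norm (c - M') = L"
        by (auto simp: c dist_norm)
      define z where "z = (c - M) / (of_real R * cis \<phi>)"
      define z' where "z' = (c - M') / (of_real R * cis \<phi>)"
      have "M = c - of_real R * cis \<phi> * z" "M' = c - of_real R * cis \<phi> * z'"
        using R by (simp_all add: z_def z'_def)
      moreover have norm_eq: "norm z = norm z'"
        by (simp add: z_def z'_def norm_divide norm_mult L)
      ultimately show "dist_power_sum n A m M = dist_power_sum n A m M'"
        by (simp only: sum_eq sum_norm_plus_roots_power_invariant[OF m s norm_eq])
    qed
  qed
qed

theorem mainTheorem4:
  fixes n :: nat and R :: real and A :: "nat \<Rightarrow> complex"
  assumes "n \<ge> 3" and "R > 0" and "regular_ngon n R A"
  shows "(\<forall>m::nat. m \<ge> 1 \<longrightarrow> (cyclic_average_exists n A m \<longleftrightarrow> 1 \<le> m \<and> m \<le> n - 1)) \<and>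
         card {m::nat. m \<ge> 1 \<and> cyclic_average_exists n A m} = n - 1"
proof -
  have iff: "cyclic_average_exists n A m \<longleftrightarrow> m < n" for m
    using assms by (simp add: cyclic_average_exists_iff_RL_sum is_RL_sum_regular_ngon_iff)
  \<comment> \<open>The condition \<open>m < n\<close> also admits \<open>m = 0\<close>; restricting
    to \<open>m \<ge> 1\<close> removes it and leaves \<open>n - 1\<close> orders.\<close>
  have "{m. m \<ge> 1 \<and> cyclic_average_exists n A m} = {1..<n}"
    by (auto simp: iff)
  then have "card {m. m \<ge> 1 \<and> cyclic_average_exists n A m} = n - 1"
    by simp
  moreover have "m < n \<longleftrightarrow> 1 \<le> m \<and> m \<le> n - 1" if "m \<ge> 1" for m
    using that assms(1) by linarith
  ultimately show ?thesis
    unfolding iff by blast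
qed

end
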